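(* For $n\ge 1$, the complete graph $K_n$ on $n$ vertices yields a binary even LCD code if and only if $n$ is odd.
   Context: A binary code of length $n$ is a linear subspace $C\subseteq\mathbb{F}_2^n$ (the zero code is allowed). Its dual $C^\perp$ is taken with respect to $\langle x,y\rangle=\sum_i x_iy_i$. $C$ is LCD (linear complementary dual) if $C\cap C^\perp=\{0\}$, equivalently $\mathbb{F}_2^n=C\oplus C^\perp$. $C$ is even if every codeword has even Hamming weight. For an LCD code $C$, the orthogonal projector $\Pi_C$ is the unique $n\times n$ matrix over $\mathbb{F}_2$ with $v\Pi_C=v$ for all row vectors $v\in C$ and $v\Pi_C=0$ for all $v\in C^\perp$. A finite simple graph on $n$ (ordered) vertices with adjacency matrix $A$ is said to yield a binary even LCD code if $A$, read over $\mathbb{F}_2$, equals $\Pi_C$ for some binary even LCD code $C$ of length $n$; this $C$ (which is the row span of $A$ over $\mathbb{F}_2$) is the code yielded by the graph. *)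

theory Defs
  imports
    "Graph_Theory.Graph_Theory"
    "Jordan_Normal_Form.VS_Connect"
    "HOL-Library.Z2"
begin

text \<open>The field \<open>F\<^sub>2\<close> is the type \<^typ>\<open>bit\<close>, and \<open>F\<^sub>2\<^sup>n\<close> is the vector space on
  \<open>carrier_vec n\<close>.\<close>

definition binary_code :: "nat \<Rightarrow> bit vec set \<Rightarrow> bool" where
  "binary_code n C \<longleftrightarrow> subspace class_ring C (module_vec TYPE(bit) n)"

definition dual_code :: "nat \<Rightarrow> bit vec set \<Rightarrow> bit vec set" where
  "dual_code n C = {y \<in> carrier_vec n. \<forall>x\<in>C. x \<bullet> y = 0}"

definition LCD_code :: "nat \<Rightarrow> bit vec set \<Rightarrow> bool" where
  "LCD_code n C \<longleftrightarrow> binary_code n C \<and> C \<inter> dual_code n C = {0\<^sub>v n}"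

definition hamming_weight :: "bit vec \<Rightarrow> nat" where
  "hamming_weight v = card {i. i < dim_vec v \<and> v $ i \<noteq> 0}"

definition even_code :: "nat \<Rightarrow> bit vec set \<Rightarrow> bool" where
  "even_code n C \<longleftrightarrow> binary_code n C \<and> (\<forall>v\<in>C. even (hamming_weight v))"

text \<open>Vectors are column vectors in the matrix library, so the row vector \<open>v P\<close> is written
  \<open>transpose_mat P *\<^sub>v v\<close>.\<close>

definition orth_projector :: "nat \<Rightarrow> bit vec set \<Rightarrow> bit mat" where
  "orth_projector n C = (THE P. P \<in> carrier_mat n n \<and>
     (\<forall>v\<in>C. transpose_mat P *\<^sub>v v = v) \<and>
     (\<forall>v\<in>dual_code n C. transpose_mat P *\<^sub>v v = 0\<^sub>v n))"

text \<open>The list \<open>vs\<close> enumerates the vertices of \<open>G\<close> without repetition; it is the vertex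
  ordering, and the matrix is already read over \<open>F\<^sub>2\<close>.\<close>

definition adjacency_mat :: "('a, 'b) pre_digraph \<Rightarrow> 'a list \<Rightarrow> bit mat" where
  "adjacency_mat G vs = mat (length vs) (length vs)
     (\<lambda>(i, j). if (vs ! i, vs ! j) \<in> arcs_ends G then 1 else 0)"

definition yields_even_LCD_code :: "('a, 'b) pre_digraph \<Rightarrow> 'a list \<Rightarrow> bool" where
  "yields_even_LCD_code G vs \<longleftrightarrow>
     (\<exists>C. LCD_code (length vs) C \<and> even_code (length vs) C \<and>
          adjacency_mat G vs = orth_projector (length vs) C)"

text \<open>The rest shows that \<^const>\<open>orth_projector\<close> is well defined on LCD codes.\<close>

lemma codeD:
  assumes "binary_code n C"
  shows "C \<subseteq> carrier_vec n" "0\<^sub>v n \<in> C" "\<And>v w. v \<in> C \<Longrightarrow> w \<in> C \<Longrightarrow> v + w \<in> C"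
proof -
  have "submodule class_ring C (module_vec TYPE(bit) n)"
    using assms unfolding binary_code_def subspace_def by simp
  then show "C \<subseteq> carrier_vec n" "0\<^sub>v n \<in> C" "\<And>v w. v \<in> C \<Longrightarrow> w \<in> C \<Longrightarrow> v + w \<in> C"
    unfolding submodule_def by (auto simp: module_vec_simps)
qed

lemma bit_vec_add_self: "v \<in> carrier_vec n \<Longrightarrow> v + v = 0\<^sub>v n" for v :: "bit vec"
  by (intro eq_vecI) (auto simp: bit_eq_iff)

lemma bit_add3: "(a + x) + (a + b) = x + b" "(a + x) + x = a" for a x b :: bit
  by (cases a; cases x; cases b; simp)+

lemma bit_vec_add3:
  fixes a x b :: "bit vec"
  assumes "a \<in> carrier_vec n" "x \<in> carrier_vec n" "b \<in> carrier_vec n"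
  shows "(a + x) + (a + b) = x + b" "(a + x) + x = a"
  using assms by (auto intro!: eq_vecI simp: bit_add3 simp del: add_uminus_conv_diff)

lemma functional_span:
  fixes D :: "bit vec set"
  assumes "finite S" "S \<subseteq> D" and D: "D \<subseteq> carrier_vec n" "0\<^sub>v n \<in> D" "\<And>v w. v \<in> D \<Longrightarrow> w \<in> D \<Longrightarrow> v + w \<in> D"
  shows "\<lbrakk>C \<subseteq> carrier_vec n; \<And>v w. v \<in> C \<Longrightarrow> w \<in> C \<Longrightarrow> v + w \<in> C; l \<in> carrier_vec n;
     \<And>x. x \<in> C \<Longrightarrow> (\<forall>s\<in>S. x \<bullet> s = 0) \<Longrightarrow> x \<bullet> l = 0\<rbrakk> \<Longrightarrow> \<exists>w\<in>D. \<forall>x\<in>C. x \<bullet> (l + w) = 0"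
  using assms(1,2)
proof (induction S arbitrary: C rule: finite_induct)
  case empty
  have "\<forall>x\<in>C. x \<bullet> (l + 0\<^sub>v n) = 0" using empty by auto
  then show ?case using D by blast
next
  case (insert s S)
  let ?C = "{x \<in> C. x \<bullet> s = 0}"
  have s: "s \<in> carrier_vec n" "s \<in> D" using insert.prems D by auto
  have "\<exists>w\<in>D. \<forall>x\<in>?C. x \<bullet> (l + w) = 0"
  proof (rule insert.IH)
    show "v + w \<in> ?C" if "v \<in> ?C" "w \<in> ?C" for v w
    proof -
      have "(v + w) \<bullet> s = v \<bullet> s + w \<bullet> s"
        using that insert.prems(1) s by (intro add_scalar_prod_distrib[of _ n]) auto
      then show ?thesis using that insert.prems(2) by auto
    qed
  qed (use insert.prems in auto)
  then obtain w where w: "w \<in> D" "\<And>x. x \<in> C \<Longrightarrow> x \<bullet> s = 0 \<Longrightarrow> x \<bullet> (l + w) = 0" by auto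
  have wc: "w \<in> carrier_vec n" "l + w \<in> carrier_vec n" using w(1) D insert.prems(3) by auto
  show ?case
  proof (cases "\<forall>x\<in>C. x \<bullet> (l + w) = 0")
    case True then show ?thesis using w by blast
  next
    case False
    then obtain y where y: "y \<in> C" "y \<bullet> (l + w) = 1" by auto
    then have ys: "y \<bullet> s = 1" using w(2)[of y] by (metis bit_not_zero_iff zero_neq_one)
    have "x \<bullet> (l + (w + s)) = 0" if x: "x \<in> C" for x
    proof -
      have xc: "x \<in> carrier_vec n" "y \<in> carrier_vec n" using x y insert.prems(1) by auto
      have e: "l + (w + s) = (l + w) + s" using wc s insert.prems(3) by (simp add: assoc_add_vec[of _ n])
      have d: "x \<bullet> (l + (w + s)) = x \<bullet> (l + w) + x \<bullet> s"
        unfolding e using scalar_prod_add_distrib[OF xc(1) wc(2) s(1)] .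
      have a: "(x + y) \<bullet> s = x \<bullet> s + y \<bullet> s" "(x + y) \<bullet> (l + w) = x \<bullet> (l + w) + y \<bullet> (l + w)"
        using add_scalar_prod_distrib[OF xc] s wc by auto
      show ?thesis
      proof (cases "x \<bullet> s = 0")
        case True then show ?thesis using d w(2)[OF x] by simp
      next
        case False
        then have "x \<bullet> s = 1" by simp
        then have "(x + y) \<bullet> s = 0" using a ys by simp
        then have "x \<bullet> (l + w) + 1 = 0" using w(2)[of "x+y"] insert.prems(2)[OF x y(1)] a y by simp
        then have "x \<bullet> (l + w) = 1" by (metis add_0 bit_not_one_iff zero_neq_one)
        then show ?thesis using d \<open>x \<bullet> s = 1\<close> by simp
      qed
    qed
    moreover have "w + s \<in> D" using w s D by auto
    ultimately show ?thesis by blast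
  qed
qed

lemma finite_bit_vecs: "finite (carrier_vec n :: bit vec set)"
proof -
  have "finite (UNIV :: bit set)"
    by (rule finite_subset[of _ "{0,1}"]) (auto intro: bit.exhaust)
  then have f: "finite {xs :: bit list. set xs \<subseteq> UNIV \<and> length xs = n}" by (rule finite_lists_length_eq)
  show ?thesis
    by (rule finite_surj[OF f, of _ vec_of_list]) (auto intro!: image_eqI[of _ _ "list_of_vec _"] simp: vec_list)
qed

lemma LCD_decomposition:
  assumes "LCD_code n C" "v \<in> carrier_vec n"
  shows "\<exists>w\<in>C. v + w \<in> dual_code n C"
proof -
  have bc: "binary_code n C" and i: "C \<inter> dual_code n C = {0\<^sub>v n}" using assms unfolding LCD_code_def by auto
  note C = codeD[OF bc]
  have f: "finite C" using C(1) finite_bit_vecs finite_subset by blast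
  have "\<exists>w\<in>C. \<forall>x\<in>C. x \<bullet> (v + w) = 0"
  proof (rule functional_span[OF f subset_refl C(1,2)])
    fix x assume x: "x \<in> C" "\<forall>s\<in>C. x \<bullet> s = 0"
    then have "x \<in> dual_code n C" using C(1) comm_scalar_prod[of x n]
      unfolding dual_code_def by (auto simp: subset_iff)
    then have "x = 0\<^sub>v n" using x i by blast
    then show "x \<bullet> v = 0" using assms by simp
  qed (use C assms in auto)
  then obtain w where w: "w \<in> C" "\<forall>x\<in>C. x \<bullet> (v + w) = 0" by blast
  then have "v + w \<in> dual_code n C" using C(1) assms(2) unfolding dual_code_def by auto
  then show ?thesis using w by blast
qed

lemma orth_projector_unique_exists:
  assumes "LCD_code n C"
  shows "\<exists>!P. P \<in> carrier_mat n n \<and>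
     (\<forall>v\<in>C. transpose_mat P *\<^sub>v v = v) \<and>
     (\<forall>v\<in>dual_code n C. transpose_mat P *\<^sub>v v = 0\<^sub>v n)"
proof -
  have bc: "binary_code n C" and i: "C \<inter> dual_code n C = {0\<^sub>v n}" using assms unfolding LCD_code_def by auto
  note C = codeD[OF bc]
  have Dc: "dual_code n C \<subseteq> carrier_vec n" unfolding dual_code_def by auto
  have Dp: "v + w \<in> dual_code n C" if "v \<in> dual_code n C" "w \<in> dual_code n C" for v w
    using that C(1) unfolding dual_code_def by (auto simp: scalar_prod_add_distrib[of _ n] subset_iff)
  have D0: "0\<^sub>v n \<in> dual_code n C" using i by auto
  obtain c where c: "\<And>v. v \<in> carrier_vec n \<Longrightarrow> c v \<in> C \<and> v + c v \<in> dual_code n C"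
    using LCD_decomposition[OF assms] by metis
  have eqI: "a = b" if "a \<in> C" "b \<in> C" "a + b \<in> dual_code n C" for a b
  proof -
    have "a + b = 0\<^sub>v n" using that C(3) i by blast
    moreover have "a \<in> carrier_vec n" "b \<in> carrier_vec n" using that C by auto
    ultimately show ?thesis
      by (metis assoc_add_vec bit_vec_add_self left_zero_vec right_zero_vec)
  qed
  have un: "c v = b" if "v \<in> carrier_vec n" "b \<in> C" "v + b \<in> dual_code n C" for v b
  proof (rule eqI)
    have k: "c v \<in> carrier_vec n" "b \<in> carrier_vec n" using c[OF that(1)] that C by auto
    have "c v + b = (v + c v) + (v + b)"
      using bit_vec_add3(1)[OF that(1) k] by simp
    then show "c v + b \<in> dual_code n C" using Dp c that by metis
  qed (use that c in auto)
  have cadd: "c (v + w) = c v + c w" if "v \<in> carrier_vec n" "w \<in> carrier_vec n" for v w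
  proof (rule un)
    have k: "c v \<in> carrier_vec n" "c w \<in> carrier_vec n" using c that C by auto
    have "v + w + (c v + c w) = (v + c v) + (w + c w)"
      using that k by (intro eq_vecI) (auto simp: ac_simps)
    then show "v + w + (c v + c w) \<in> dual_code n C" using Dp c that by metis
  qed (use that c C in auto)
  have c0: "c (0\<^sub>v n) = 0\<^sub>v n" by (rule un) (use C D0 in auto)
  define P where "P = transpose_mat (mat_of_cols n (map (\<lambda>i. c (unit_vec n i)) [0..<n]))"
  have Pc: "P \<in> carrier_mat n n" unfolding P_def by (auto simp: mat_of_cols_def)
  have part: "transpose_mat P *\<^sub>v (vec n (\<lambda>i. if i < k then v $ i else 0)) = c (vec n (\<lambda>i. if i < k then v $ i else 0))"
    if "v \<in> carrier_vec n" "k \<le> n" for v k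
    using that(2)
  proof (induction k)
    case 0
    have "vec n (\<lambda>i. if i < (0::nat) then v $ i else 0) = 0\<^sub>v n" by auto
    moreover have "transpose_mat P *\<^sub>v 0\<^sub>v n = 0\<^sub>v n" using Pc by (auto intro!: eq_vecI)
    ultimately show ?case using c0 by simp
  next
    case (Suc k)
    let ?v = "\<lambda>k. vec n (\<lambda>i. if i < k then v $ i else 0)"
    show ?case
    proof (cases "v $ k = 0")
      case True
      have "?v (Suc k) = ?v k" using True by (auto simp: less_Suc_eq)
      then show ?thesis using Suc by auto
    next
      case False
      then have e: "?v (Suc k) = ?v k + unit_vec n k" using Suc.prems by (auto simp: less_Suc_eq)
      have u: "transpose_mat P *\<^sub>v unit_vec n k = c (unit_vec n k)"
      proof -
        have "transpose_mat P *\<^sub>v unit_vec n k = col (transpose_mat P) k"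
          using Suc.prems Pc by (auto intro!: eq_vecI)
        also have "\<dots> = c (unit_vec n k)" unfolding P_def using Suc.prems c[of "unit_vec n k"] C(1)
          by (auto simp: subset_iff)
        finally show ?thesis .
      qed
      have "transpose_mat P *\<^sub>v ?v (Suc k) = transpose_mat P *\<^sub>v ?v k + transpose_mat P *\<^sub>v unit_vec n k"
        unfolding e by (rule mult_add_distrib_mat_vec[of _ n n]) (use Pc in auto)
      also have "\<dots> = c (?v (Suc k))" unfolding e u using Suc by (subst cadd) auto
      finally show ?thesis .
    qed
  qed
  have PcV: "transpose_mat P *\<^sub>v v = c v" if "v \<in> carrier_vec n" for v
  proof -
    have "vec n (\<lambda>i. if i < n then v $ i else 0) = v" using that by (auto intro!: eq_vecI)
    then show ?thesis using part[OF that, of n] by simp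
  qed
  show ?thesis
  proof (rule ex1I[of _ P], intro conjI ballI)
    show "transpose_mat P *\<^sub>v v = v" if "v \<in> C" for v
      using that C PcV un[of v v] bit_vec_add_self[of v n] D0 by auto
    show "transpose_mat P *\<^sub>v v = 0\<^sub>v n" if "v \<in> dual_code n C" for v
      using that C Dc PcV[of v] un[of v "0\<^sub>v n"] by (auto simp: subset_iff)
  next
    fix Q assume Q: "Q \<in> carrier_mat n n \<and> (\<forall>v\<in>C. transpose_mat Q *\<^sub>v v = v) \<and> (\<forall>v\<in>dual_code n C. transpose_mat Q *\<^sub>v v = 0\<^sub>v n)"
    have q: "transpose_mat Q *\<^sub>v v = c v" if v: "v \<in> carrier_vec n" for v
    proof -
      have k: "c v \<in> C" "c v \<in> carrier_vec n" "v + c v \<in> dual_code n C" using c[OF v] C by auto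
      have e: "v = (v + c v) + c v" using bit_vec_add3(2)[OF v k(2) k(2)] by simp
      have "transpose_mat Q *\<^sub>v v = transpose_mat Q *\<^sub>v (v + c v) + transpose_mat Q *\<^sub>v c v"
        using mult_add_distrib_mat_vec[of "transpose_mat Q" n n "v + c v" "c v"] Q v k e by auto
      also have "\<dots> = c v" using Q k by auto
      finally show ?thesis .
    qed
    have "col (transpose_mat Q) j = col (transpose_mat P) j" if "j < n" for j
    proof -
      have "M *\<^sub>v unit_vec n j = col M j" if "M \<in> carrier_mat n n" for M :: "bit mat"
        using that \<open>j < n\<close> by (auto intro!: eq_vecI)
      then show ?thesis using Q Pc q[of "unit_vec n j"] PcV[of "unit_vec n j"] by (metis transpose_carrier_mat unit_vec_carrier)
    qed
    then have "transpose_mat Q = transpose_mat P"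
      using Q Pc by (intro mat_col_eqI) auto
    then show "Q = P" by simp
  qed (rule Pc)
qed

end

theory Submission
  imports Defs
begin

text \<open>Over \<open>F\<^sub>2\<close> the adjacency matrix of \<open>K\<^sub>n\<close> is \<open>J - I\<close>, which sends \<open>v\<close> to
  \<open>(\<Sum>\<^sub>i v\<^sub>i) e + v\<close>, where \<open>e\<close> is the all-ones vector. For odd \<open>n\<close> it therefore fixes the
  code of all even-weight vectors and kills its dual \<open>{0, e}\<close>, and the code is LCD since \<open>e\<close>
  has odd weight. For even \<open>n\<close> its columns have odd weight \<open>n - 1\<close>, whereas the columns of
  the projector, a symmetric matrix here, lie in the code.\<close>

lemma of_nat_bit_eq_0_iff: "(of_nat k :: bit) = 0 \<longleftrightarrow> even k"
  by (induction k) (auto simp: add_eq_0_iff)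

text \<open>Every nonzero entry over \<open>bit\<close> is 1, so summing the entries counts the
  support modulo 2. Weight parity thereby becomes a linear condition.\<close>

lemma of_nat_hamming_weight: "of_nat (hamming_weight v) = (\<Sum>i<dim_vec v. v $ i)"
proof -
  have "(\<Sum>i<dim_vec v. v $ i) = (\<Sum>i\<in>{i. i < dim_vec v \<and> v $ i \<noteq> 0}. v $ i)"
    by (rule sum.mono_neutral_right) auto
  also have "\<dots> = (\<Sum>i\<in>{i. i < dim_vec v \<and> v $ i \<noteq> 0}. 1)"
    by (rule sum.cong) auto
  finally show ?thesis by (simp add: hamming_weight_def)
qed

lemma even_hamming_weight_iff: "even (hamming_weight v) \<longleftrightarrow> (\<Sum>i<dim_vec v. v $ i) = 0"
  by (simp flip: of_nat_hamming_weight of_nat_bit_eq_0_iff)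

definition complete_mat :: "nat \<Rightarrow> bit mat" where
  "complete_mat n = mat n n (\<lambda>(i, j). if i = j then 0 else 1)"

lemma complete_mat_carrier: "complete_mat n \<in> carrier_mat n n"
  by (simp add: complete_mat_def)

lemma transpose_complete_mat: "transpose_mat (complete_mat n) = complete_mat n"
  by (rule eq_matI) (auto simp: complete_mat_def)

lemma complete_mat_mult_vec:
  assumes "v \<in> carrier_vec n"
  shows "complete_mat n *\<^sub>v v = vec n (\<lambda>i. (\<Sum>j<n. v $ j) + v $ i)"
proof (rule eq_vecI)
  fix i assume "i < dim_vec (vec n (\<lambda>i. (\<Sum>j<n. v $ j) + v $ i))"
  then have i: "i < n" by simp
  have "(complete_mat n *\<^sub>v v) $ i = (\<Sum>j<n. (if i = j then 0 else 1) * v $ j)"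
    using assms i by (simp add: complete_mat_def scalar_prod_def atLeast0LessThan)
  \<comment> \<open>In characteristic 2, leaving out the term \<open>j = i\<close> amounts to adding
    it a second time.\<close>
  also have "\<dots> = (\<Sum>j<n. v $ j + (if j = i then v $ j else 0))"
    by (rule sum.cong) auto
  also have "\<dots> = (\<Sum>j<n. v $ j) + v $ i"
    unfolding sum.distrib using i by (simp only: sum.delta finite_lessThan lessThan_iff if_True)
  finally show "(complete_mat n *\<^sub>v v) $ i = vec n (\<lambda>i. (\<Sum>j<n. v $ j) + v $ i) $ i"
    using i by simp
qed (simp add: complete_mat_def)

text \<open>Arcs join exactly the pairs of distinct vertices, and distinctness of \<open>vs\<close>
  turns this into distinct indices. Hence the matrix does not depend on the vertex order.\<close>

lemma adjacency_mat_complete_digraph: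
  assumes "complete_digraph n G" "distinct vs" "set vs = verts G"
  shows "length vs = n" "adjacency_mat G vs = complete_mat n"
proof -
  show len: "length vs = n"
    using assms distinct_card[of vs] by (simp add: complete_digraph_def)
  have "(vs ! i, vs ! j) \<in> arcs_ends G \<longleftrightarrow> i \<noteq> j" if "i < n" "j < n" for i j
  proof -
    have "vs ! i \<in> verts G" "vs ! j \<in> verts G"
      using that len assms(3) nth_mem by metis+
    then show ?thesis
      using assms(1,2) that len by (simp add: complete_digraph_def nth_eq_iff_index_eq)
  qed
  then show "adjacency_mat G vs = complete_mat n"
    using len by (intro eq_matI) (auto simp: adjacency_mat_def complete_mat_def)
qed

lemma orth_projector_props:
  assumes "LCD_code n C"
  shows "orth_projector n C \<in> carrier_mat n n"
    "\<And>v. v \<in> C \<Longrightarrow> transpose_mat (orth_projector n C) *\<^sub>v v = v"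
    "\<And>v. v \<in> dual_code n C \<Longrightarrow> transpose_mat (orth_projector n C) *\<^sub>v v = 0\<^sub>v n"
  using theI'[OF orth_projector_unique_exists[OF assms], folded orth_projector_def] by auto

lemma orth_projector_eqI:
  assumes "LCD_code n C" "P \<in> carrier_mat n n"
    "\<And>v. v \<in> C \<Longrightarrow> transpose_mat P *\<^sub>v v = v"
    "\<And>v. v \<in> dual_code n C \<Longrightarrow> transpose_mat P *\<^sub>v v = 0\<^sub>v n"
  shows "orth_projector n C = P"
  unfolding orth_projector_def
  by (rule the1_equality[OF orth_projector_unique_exists[OF assms(1)]]) (use assms in auto)

text \<open>Split \<open>v\<close> as \<open>(v + w) + w\<close> with \<open>w\<close> in
  \<open>C\<close> and \<open>v + w\<close> in the dual: the projector kills the first summand and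
  fixes the second, so the image is \<open>w\<close>.\<close>

lemma orth_projector_mult_vec_in_code:
  assumes "LCD_code n C" "v \<in> carrier_vec n"
  shows "transpose_mat (orth_projector n C) *\<^sub>v v \<in> C"
proof -
  let ?P = "transpose_mat (orth_projector n C)"
  note P = orth_projector_props[OF assms(1)]
  obtain w where w: "w \<in> C" "v + w \<in> dual_code n C"
    using LCD_decomposition[OF assms] by blast
  have wc: "w \<in> carrier_vec n"
    using w(1) assms(1) codeD(1) by (auto simp: LCD_code_def)
  have "?P *\<^sub>v v = ?P *\<^sub>v ((v + w) + w)"
    using bit_vec_add3(2)[OF assms(2) wc wc] by simp
  also have "\<dots> = ?P *\<^sub>v (v + w) + ?P *\<^sub>v w"
    using P(1) assms(2) wc by (intro mult_add_distrib_mat_vec[of _ n n]) auto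
  also have "\<dots> = w"
    using P(2)[OF w(1)] P(3)[OF w(2)] wc by simp
  finally show ?thesis using w(1) by simp
qed

text \<open>Even weight is encoded as a vanishing coordinate sum, which makes closure under addition
  immediate.\<close>

definition even_weight_code :: "nat \<Rightarrow> bit vec set" where
  "even_weight_code n = {v \<in> carrier_vec n. (\<Sum>i<n. v $ i) = 0}"

lemma sum_add_vec:
  assumes "v \<in> carrier_vec n" "w \<in> carrier_vec n"
  shows "(\<Sum>i<n. (v + w) $ i) = (\<Sum>i<n. v $ i) + (\<Sum>i<n. w $ i)"
proof -
  have "(\<Sum>i<n. (v + w) $ i) = (\<Sum>i<n. v $ i + w $ i)"
    by (rule sum.cong) (use assms in auto)
  then show ?thesis by (simp only: sum.distrib)
qed

lemma sum_unit_vec: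
  assumes "i < n"
  shows "(\<Sum>j<n. unit_vec n i $ j) = (1 :: 'a :: semiring_1)"
proof -
  have "(\<Sum>j<n. unit_vec n i $ j) = (\<Sum>j<n. if j = i then 1 else 0 :: 'a)"
    by (rule sum.cong) (use assms in auto)
  then show ?thesis using assms by simp
qed

lemma binary_code_even_weight_code: "binary_code n (even_weight_code n)"
  unfolding binary_code_def subspace_def
proof (intro conjI submodule.intro)
  show "vectorspace class_ring (module_vec TYPE(bit) n)"
    by (rule vec_vs)
  show "Module.module class_ring (module_vec TYPE(bit) n)"
    by (rule vec_module)
  show "c \<odot>\<^bsub>module_vec TYPE(bit) n\<^esub> v \<in> even_weight_code n"
    if "v \<in> even_weight_code n" for c :: bit and v
    by (cases c) (use that in \<open>auto simp: even_weight_code_def module_vec_simps\<close>)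
qed (auto simp: even_weight_code_def module_vec_simps sum_add_vec simp del: index_add_vec)

lemma even_code_even_weight_code: "even_code n (even_weight_code n)"
  using binary_code_even_weight_code
  by (auto simp: even_code_def even_weight_code_def even_hamming_weight_iff)

text \<open>Pairing \<open>y\<close> with the codeword \<open>unit_vec n i + unit_vec n j\<close>,
  which is zero when \<open>i = j\<close>, gives \<open>y $ i + y $ j = 0\<close>.\<close>

lemma dual_even_weight_code_constant:
  assumes "y \<in> dual_code n (even_weight_code n)" "i < n" "j < n"
  shows "y $ i = y $ j"
proof -
  have y: "y \<in> carrier_vec n" and
    orth: "\<And>x. x \<in> even_weight_code n \<Longrightarrow> x \<bullet> y = 0"
    using assms(1) by (auto simp: dual_code_def)
  let ?x = "unit_vec n i + unit_vec n j :: bit vec"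
  have "(\<Sum>k<n. ?x $ k) = 0"
    using assms(2,3) by (simp add: sum_add_vec sum_unit_vec del: index_add_vec)
  then have "?x \<bullet> y = 0"
    by (intro orth) (simp add: even_weight_code_def)
  moreover have "?x \<bullet> y = y $ i + y $ j"
    using y assms(2,3) by (simp add: add_scalar_prod_distrib[of _ n])
  ultimately show ?thesis by (cases "y $ i"; cases "y $ j") simp_all
qed

text \<open>All entries of \<open>y\<close> agree, so their sum is \<open>n\<close> copies of one
  entry, and odd \<open>n\<close> is 1 in \<open>bit\<close>.\<close>

lemma sum_dual_even_weight_code:
  assumes "odd n" "y \<in> dual_code n (even_weight_code n)" "i < n"
  shows "(\<Sum>j<n. y $ j) = y $ i"
proof -
  have "(\<Sum>j<n. y $ j) = (\<Sum>j<n. y $ i)"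
    by (rule sum.cong) (use dual_even_weight_code_constant[OF assms(2) _ assms(3)] in blast)+
  also have "\<dots> = of_nat n * y $ i"
    by (simp only: sum_constant card_lessThan)
  also have "of_nat n = (1 :: bit)"
    using assms(1) of_nat_bit_eq_0_iff[of n] by (metis bit_not_zero_iff)
  finally show ?thesis by (simp only: mult_1_left)
qed

lemma LCD_even_weight_code:
  assumes "odd n"
  shows "LCD_code n (even_weight_code n)"
proof -
  let ?C = "even_weight_code n"
  \<comment> \<open>Each entry equals the coordinate sum because \<open>y\<close> is in the dual,
    and that sum vanishes because \<open>y\<close> is in the code.\<close>
  have "y = 0\<^sub>v n" if "y \<in> ?C" "y \<in> dual_code n ?C" for y
    using that sum_dual_even_weight_code[OF assms that(2)]
    by (intro eq_vecI) (auto simp: even_weight_code_def)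
  moreover have "0\<^sub>v n \<in> ?C" "0\<^sub>v n \<in> dual_code n ?C"
    by (auto simp: even_weight_code_def dual_code_def)
  ultimately show ?thesis
    unfolding LCD_code_def using binary_code_even_weight_code by blast
qed

lemma orth_projector_even_weight_code:
  assumes "odd n"
  shows "orth_projector n (even_weight_code n) = complete_mat n"
proof (rule orth_projector_eqI[OF LCD_even_weight_code[OF assms] complete_mat_carrier])
  fix v assume "v \<in> even_weight_code n"
  then show "transpose_mat (complete_mat n) *\<^sub>v v = v"
    by (intro eq_vecI) (auto simp: transpose_complete_mat complete_mat_mult_vec even_weight_code_def)
next
  fix v assume v: "v \<in> dual_code n (even_weight_code n)"
  then have "v \<in> carrier_vec n" by (simp add: dual_code_def)
  \<comment> \<open>On the dual the coordinate sum equals every entry, so each entry of the image is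
    \<open>v $ i + v $ i = 0\<close>.\<close>
  then show "transpose_mat (complete_mat n) *\<^sub>v v = 0\<^sub>v n"
    using sum_dual_even_weight_code[OF assms v]
    by (intro eq_vecI) (auto simp: transpose_complete_mat complete_mat_mult_vec)
qed

text \<open>The column is the all-ones vector plus \<open>unit_vec n i\<close>, so its coordinate
  sum is \<open>n + 1\<close>, which is 1 for even \<open>n\<close>.\<close>

lemma complete_mat_odd_column:
  assumes "even n" "i < n"
  shows "odd (hamming_weight (complete_mat n *\<^sub>v unit_vec n i))"
proof -
  let ?e = "unit_vec n i :: bit vec"
  have e: "(\<Sum>j<n. ?e $ j) = 1"
    using assms(2) by (rule sum_unit_vec)
  have "complete_mat n *\<^sub>v ?e = vec n (\<lambda>j. 1 + ?e $ j)"
    by (subst complete_mat_mult_vec) (simp_all only: e unit_vec_carrier)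
  then have "(\<Sum>j<n. (complete_mat n *\<^sub>v ?e) $ j) = of_nat n + (\<Sum>j<n. ?e $ j)"
    by (simp add: sum.distrib del: add_bit_eq_xor sum.delta)
  also have "\<dots> = 1"
    unfolding e using assms(1) of_nat_bit_eq_0_iff[of n] by simp
  finally show ?thesis
    by (simp add: even_hamming_weight_iff complete_mat_def)
qed

theorem corollary4p4:
  fixes n :: nat
    and G :: "('a, 'b) pre_digraph"
    and vs :: "'a list"
  assumes "n \<ge> 1"
    and "complete_digraph n G"
    and "distinct vs" and "set vs = verts G"
  shows "yields_even_LCD_code G vs \<longleftrightarrow> odd n"
proof -
  note K = adjacency_mat_complete_digraph[OF assms(2-4)]
  show ?thesis
  proof
    assume "yields_even_LCD_code G vs"
    then obtain C where C: "LCD_code n C" "even_code n C" "orth_projector n C = complete_mat n"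
      unfolding yields_even_LCD_code_def K by metis
    \<comment> \<open>Since \<open>n \<ge> 1\<close>, there is a column 0. Lying in
      \<open>C\<close>, it has even weight, which is impossible for even \<open>n\<close>.\<close>
    have "complete_mat n *\<^sub>v unit_vec n 0 \<in> C"
      using orth_projector_mult_vec_in_code[OF C(1), of "unit_vec n 0"]
      by (simp add: C(3) transpose_complete_mat)
    then show "odd n"
      using C(2) complete_mat_odd_column[of n 0] assms(1) by (auto simp: even_code_def)
  next
    assume "odd n"
    \<comment> \<open>The witness is \<open>even_weight_code n\<close>.\<close>
    then show "yields_even_LCD_code G vs"
      unfolding yields_even_LCD_code_def K
      using LCD_even_weight_code even_code_even_weight_code orth_projector_even_weight_code
      by metis
  qed
qed

end
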